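(* If $\Omega\subset\mathbb{C}^d$ is a $\mathbb{C}$-properly convex domain, $z_0\in\Omega$, $\xi\in\partial\Omega$, $H$ is a supporting complex hyperplane of $\Omega$ at $\xi$, $q\in(\xi,z_0]$, and $$r:=\frac{\delta_\Omega(z_0)}{\|\xi-z_0\|},$$ then there exists an affine map $A$ with the following properties: (1) $A\Omega\in\mathbb{K}_d(r)$; (2) $A(q)=0$; (3) $A(\xi)=e_1$; (4) $A(H)=e_1+\mathrm{Span}_{\mathbb{C}}\{e_2,\dots,e_d\}$; and (5) if $\delta_H=\max\{\delta_\Omega(q;v): v\in-\xi+H \text{ non-zero}\}$, then $$\|A(z_1)-A(z_2)\|\ge\frac{r}{\sqrt2\,\delta_H}\|z_1-z_2\|\quad\text{for all } z_1,z_2\in\mathbb{C}^d.$$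
   Context: A convex domain in $\mathbb{C}^d$ is $\mathbb{C}$-properly convex if it contains no entire complex affine line. "Affine map" means a complex affine automorphism of $\mathbb{C}^d$. $\|\cdot\|$ is the Euclidean norm and $e_1,\dots,e_d$ the standard basis of $\mathbb{C}^d$; $\mathbb{D}\subset\mathbb{C}$ is the open unit disk. $(\xi,z_0]$ is the real segment from $\xi$ (excluded) to $z_0$ (included). A supporting complex hyperplane of $\Omega$ at $\xi$ is a complex affine hyperplane $H$ with $\xi\in H$ and $H\cap\Omega=\emptyset$; $-\xi+H$ is the complex hyperplane through $0$ parallel to $H$. For $z\in\Omega$ and $v\in\mathbb{C}^d\setminus\{0\}$: $\delta_\Omega(z)=\inf\{\|z-w\|:w\in\partial\Omega\}$ and $\delta_\Omega(z;v)=\inf\{\|z-w\|:w\in\partial\Omega\cap(z+\mathbb{C}\cdot v)\}$. For $r\in(0,1]$, $\mathbb{K}_d(r)$ is the set of $\mathbb{C}$-properly convex domains $\Omega\subset\mathbb{C}^d$ such that (i) $r\mathbb{D}\cdot e_1\subset\Omega$ and $\mathbb{D}\cdot e_j\subset\Omega$ for $j=2,\dots,d$; and (ii) for every $j=1,\dots,d$, $e_j\in\partial\Omega$ and $(e_j+\mathrm{Span}_{\mathbb{C}}\{e_{j+1},\dots,e_d\})\cap\Omega=\emptyset$. *)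

theory Defs
  imports "HOL-Analysis.Analysis"
begin

(* C^d is complex ^ 'n with d = CARD('n) >= 1; its norm is the Euclidean one.  The linear order
   on the finite type 'n is the enumeration 1 < 2 < ... < d of the coordinates, so that
   Min UNIV is the index 1 and {j<..} is {j+1,...,d}.  Complex scalars act by *s, and vec.span,
   vec.subspace and vec.dim are span, subspace and dimension over the complex numbers. *)

abbreviation std_basis :: "'n \<Rightarrow> complex ^ 'n::finite" where
  "std_basis j \<equiv> axis j 1"

abbreviation idx1 :: "'n::{finite,linorder}" where
  "idx1 \<equiv> Min UNIV"

definition complex_line :: "complex ^ 'n \<Rightarrow> complex ^ 'n \<Rightarrow> (complex ^ 'n::finite) set" where
  "complex_line z v = {z + c *s v | c. True}"

(* Connectedness of the domain follows from convexity. *)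
definition C_properly_convex_domain :: "(complex ^ 'n::finite) set \<Rightarrow> bool" where
  "C_properly_convex_domain \<Omega> \<longleftrightarrow>
     open \<Omega> \<and> \<Omega> \<noteq> {} \<and> convex \<Omega> \<and> \<not> (\<exists>z v. v \<noteq> 0 \<and> complex_line z v \<subseteq> \<Omega>)"

definition affine_automorphism :: "(complex ^ 'n \<Rightarrow> complex ^ 'n::finite) \<Rightarrow> bool" where
  "affine_automorphism A \<longleftrightarrow> (\<exists>M b. invertible M \<and> A = (\<lambda>z. M *v z + b))"

definition complex_affine_hyperplane :: "(complex ^ 'n::finite) set \<Rightarrow> bool" where
  "complex_affine_hyperplane H \<longleftrightarrow>
     (\<exists>a V. vec.subspace V \<and> vec.dim V = CARD('n) - 1 \<and> H = (+) a ` V)"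

definition supporting_complex_hyperplane ::
    "(complex ^ 'n::finite) set \<Rightarrow> complex ^ 'n \<Rightarrow> (complex ^ 'n) set \<Rightarrow> bool" where
  "supporting_complex_hyperplane \<Omega> \<xi> H \<longleftrightarrow>
     complex_affine_hyperplane H \<and> \<xi> \<in> H \<and> H \<inter> \<Omega> = {}"

(* infdist is the infimum of the distances, except that it is 0 for the empty set.  The sets
   below are nonempty when \<Omega> is a C-properly convex domain, z \<in> \<Omega> and v \<noteq> 0. *)
definition bdist :: "(complex ^ 'n::finite) set \<Rightarrow> complex ^ 'n \<Rightarrow> real" where
  "bdist \<Omega> z = infdist z (frontier \<Omega>)"

definition bdist_dir ::
    "(complex ^ 'n::finite) set \<Rightarrow> complex ^ 'n \<Rightarrow> complex ^ 'n \<Rightarrow> real" where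
  "bdist_dir \<Omega> z v = infdist z (frontier \<Omega> \<inter> complex_line z v)"

(* The family is only considered for r in (0,1]; here it is empty for all other r. *)
definition K_family :: "real \<Rightarrow> (complex ^ 'n::{finite,linorder}) set set" where
  "K_family r = {\<Omega>. 0 < r \<and> r \<le> 1 \<and> C_properly_convex_domain \<Omega> \<and>
     (\<lambda>c. c *s std_basis idx1) ` ball 0 r \<subseteq> \<Omega> \<and>
     (\<forall>j. j \<noteq> idx1 \<longrightarrow> (\<lambda>c. c *s std_basis j) ` ball 0 1 \<subseteq> \<Omega>) \<and>
     (\<forall>j. std_basis j \<in> frontier \<Omega> \<and>
          ((+) (std_basis j) ` vec.span (std_basis ` {j<..})) \<inter> \<Omega> = {})}"

end

theory Submission
  imports Defs
begin

text \<open>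
  Write \<open>V\<close> for the hyperplane through 0 parallel to \<open>H\<close>.  A point \<open>b\<close> of \<open>V\<close> for which \<open>q + b\<close>
  is a nearest boundary point of \<open>\<Omega>\<close> in \<open>q + V\<close> has the property that the complex affine subspace
  of \<open>q + V\<close> through \<open>q + b\<close> orthogonal to \<open>b\<close> misses \<open>\<Omega>\<close>.  Iterating inside \<open>V \<inter> b\<^sup>\<bottom>\<close> yields an
  orthogonal basis \<open>b\<^sub>2, \<dots>, b\<^sub>d\<close> of \<open>V\<close>; with \<open>b\<^sub>1 = \<xi> - q\<close>, the affine map sending \<open>q\<close> to 0
  and \<open>q + b\<^sub>j\<close> to \<open>e\<^sub>j\<close> is the required one.  Its inverse expands by at most
  \<open>sqrt 2 \<delta>\<^sub>H / r\<close>: the \<open>b\<^sub>j\<close> with \<open>j \<ge> 2\<close> are orthogonal of norm at most \<open>\<delta>\<^sub>H\<close>, and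
  \<open>r \<parallel>\<xi> - q\<parallel> \<le> \<delta>\<^sub>H\<close> because the convex hull of \<open>\<xi>\<close> and the ball of radius \<open>\<delta>\<^sub>\<Omega>(z\<^sub>0)\<close> about \<open>z\<^sub>0\<close>
  contains a ball of radius \<open>r \<parallel>\<xi> - q\<parallel>\<close> about \<open>q\<close>.
\<close>

lemma of_real_smult_vec: "of_real t *s (x :: complex ^ 'n::finite) = t *\<^sub>R x"
  unfolding vec_eq_iff vector_smult_component vector_scaleR_component
  by (simp add: scaleR_conv_of_real)

lemma norm_smult_vec: "norm (c *s (x :: complex ^ 'n::finite)) = cmod c * norm x"
  by (simp add: norm_vec_def norm_mult L2_set_right_distrib)

lemma subspace_if_vec_subspace:
  fixes V :: "(complex ^ 'n::finite) set"
  assumes "vec.subspace V"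
  shows "subspace V"
  by (rule subspaceI)
    (use assms in \<open>auto simp: vec.subspace_0 vec.subspace_add vec.subspace_scale
      simp flip: of_real_smult_vec\<close>)

lemma continuous_on_smult_vec [continuous_intros]:
  fixes f :: "'a::topological_space \<Rightarrow> complex ^ 'n::finite"
  assumes "continuous_on S f"
  shows "continuous_on S (\<lambda>x. c *s f x)"
  unfolding vector_scalar_mult_def
  by (intro continuous_intros assms)

definition herm :: "complex ^ 'n::finite \<Rightarrow> complex ^ 'n \<Rightarrow> complex" where
  "herm x y = (\<Sum>i\<in>UNIV. x $ i * cnj (y $ i))"

lemma herm_add_left: "herm (x + y) z = herm x z + herm y z"
  and herm_diff_left: "herm (x - y) z = herm x z - herm y z"
  and herm_smult_left: "herm (c *s x) z = c * herm x z"
  and herm_smult_right: "herm x (c *s z) = cnj c * herm x z"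
  and herm_zero_left [simp]: "herm 0 z = 0"
  by (simp_all add: herm_def sum.distrib sum_subtractf sum_distrib_left algebra_simps)

lemma herm_commute: "herm y x = cnj (herm x y)"
  by (simp add: herm_def mult.commute)

lemma inner_eq_Re_herm: "x \<bullet> y = Re (herm x y)"
  by (simp add: inner_vec_def herm_def inner_complex_def)

lemma herm_self_eq_0_iff [simp]: "herm x x = 0 \<longleftrightarrow> x = 0"
  using inner_eq_Re_herm[of x x] by auto

lemma frontier_on_segment:
  fixes p u :: "complex ^ 'n::finite"
  assumes "p \<in> \<Omega>" "p + u \<notin> \<Omega>"
  shows "\<exists>t. 0 \<le> t \<and> t \<le> 1 \<and> p + of_real t *s u \<in> frontier \<Omega>"
proof -
  have "closed_segment p (p + u) \<inter> frontier \<Omega> \<noteq> {}"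
    by (rule connected_Int_frontier) (use assms in auto)
  then obtain x where "x \<in> closed_segment p (p + u)" "x \<in> frontier \<Omega>" by auto
  then obtain t where "0 \<le> t" "t \<le> 1" "x = (1 - t) *\<^sub>R p + t *\<^sub>R (p + u)"
    by (auto simp: in_segment)
  moreover from this have "x = p + of_real t *s u"
    by (simp add: of_real_smult_vec algebra_simps)
  ultimately show ?thesis using \<open>x \<in> frontier \<Omega>\<close> by auto
qed

lemma frontier_on_line:
  assumes "C_properly_convex_domain \<Omega>" "q \<in> \<Omega>" "v \<noteq> 0"
  shows "frontier \<Omega> \<inter> complex_line q v \<noteq> {}"
proof -
  have "\<not> complex_line q v \<subseteq> \<Omega>"
    using assms unfolding C_properly_convex_domain_def by blast
  then obtain c where "q + c *s v \<notin> \<Omega>"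
    by (auto simp: complex_line_def)
  from frontier_on_segment[OF \<open>q \<in> \<Omega>\<close> this] obtain t
    where "q + of_real t *s (c *s v) \<in> frontier \<Omega>" by blast
  moreover have "q + of_real t *s (c *s v) \<in> complex_line q v"
    by (auto simp: complex_line_def)
  ultimately show ?thesis by blast
qed

lemma disc_subset_if_frontier_far:
  assumes "q \<in> \<Omega>" "cmod c * norm v < \<rho>"
    and far: "\<And>c. q + c *s v \<in> frontier \<Omega> \<Longrightarrow> \<rho> \<le> cmod c * norm v"
  shows "q + c *s v \<in> \<Omega>"
proof (rule ccontr)
  assume "q + c *s v \<notin> \<Omega>"
  from frontier_on_segment[OF \<open>q \<in> \<Omega>\<close> this] obtain t
    where t: "0 \<le> t" "t \<le> 1" "q + (of_real t * c) *s v \<in> frontier \<Omega>" by auto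
  have "\<rho> \<le> t * (cmod c * norm v)"
    using far[OF t(3)] t(1) by (simp add: norm_mult mult.assoc)
  also have "\<dots> \<le> cmod c * norm v"
    using t by (simp add: mult_left_le_one_le)
  finally show False using assms(2) by simp
qed

lemma nearest_frontier_point_in_subspace:
  assumes dom: "C_properly_convex_domain \<Omega>" and q: "q \<in> \<Omega>"
    and W: "vec.subspace W" "W \<noteq> {0}"
  obtains x where "x \<in> W" "x \<noteq> 0" "q + x \<in> frontier \<Omega>"
    "\<And>y. y \<in> W \<Longrightarrow> norm y < norm x \<Longrightarrow> q + y \<in> \<Omega>"
proof -
  have "open \<Omega>" using dom by (simp add: C_properly_convex_domain_def)
  define F where "F = {x \<in> W. q + x \<in> frontier \<Omega>}"
  have "closed F"
  proof -
    have "closed ((\<lambda>x. q + x) -` frontier \<Omega>)"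
      by (intro closed_vimage frontier_closed continuous_intros)
    moreover have "closed W" by (simp add: W(1) closed_subspace subspace_if_vec_subspace)
    moreover have "F = W \<inter> (\<lambda>x. q + x) -` frontier \<Omega>" by (auto simp: F_def)
    ultimately show ?thesis by auto
  qed
  moreover have "F \<noteq> {}"
  proof -
    obtain w where "w \<in> W" "w \<noteq> 0" using W vec.subspace_0 by blast
    with frontier_on_line[OF dom q] show ?thesis
      using vec.subspace_scale[OF W(1)] by (fastforce simp: F_def complex_line_def)
  qed
  ultimately obtain x where x: "x \<in> F" "\<And>y. y \<in> F \<Longrightarrow> dist 0 x \<le> dist 0 y"
    using distance_attains_inf[of F 0] by blast
  show thesis
  proof
    show "x \<in> W" "q + x \<in> frontier \<Omega>" using x by (auto simp: F_def)
    then show "x \<noteq> 0" using q frontier_disjoint_eq[of \<Omega>] \<open>open \<Omega>\<close> by auto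
    fix y assume y: "y \<in> W" "norm y < norm x"
    have "norm x \<le> cmod c * norm y" if "q + c *s y \<in> frontier \<Omega>" for c
      using x(2)[of "c *s y"] that y vec.subspace_scale[OF W(1)]
      by (auto simp: F_def norm_smult_vec)
    from disc_subset_if_frontier_far[OF q _ this, of 1] show "q + y \<in> \<Omega>"
      using y by auto
  qed
qed

lemma tangent_plane_disjoint_if_ball_subset:
  fixes q x w :: "complex ^ 'n::finite"
  assumes \<Omega>: "open \<Omega>" "convex \<Omega>" and x: "q + x \<notin> \<Omega>"
    and W: "subspace W" "x \<in> W" "w \<in> W"
    and ball: "\<And>y. y \<in> W \<Longrightarrow> norm y < norm x \<Longrightarrow> q + y \<in> \<Omega>"
    and orth: "orthogonal x w" and "x \<noteq> 0"
  shows "q + x + w \<notin> \<Omega>"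
proof
  assume "q + x + w \<in> \<Omega>"
  then obtain e where e: "e > 0" "\<And>y. dist y (q + x + w) < e \<Longrightarrow> y \<in> \<Omega>"
    using \<Omega>(1) unfolding open_dist by blast
  \<comment> \<open>Moving the point slightly outwards makes the line from it through \<open>q + x\<close> enter the ball:
    \<open>q + x\<close> is the point at ratio \<open>\<mu>\<close> from \<open>q + y\<close> below, and \<open>norm y < norm x\<close> once \<open>\<mu>\<close> is small.\<close>
  define \<epsilon> a b where "\<epsilon> = e / (2 * norm x)" and "a = norm x ^ 2" and "b = norm w ^ 2"
  have pos: "\<epsilon> > 0" "a > 0" "b \<ge> 0" using e(1) \<open>x \<noteq> 0\<close> by (auto simp: \<epsilon>_def a_def b_def)
  have p: "q + (1 + \<epsilon>) *\<^sub>R x + w \<in> \<Omega>"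
    by (rule e(2)) (use e(1) \<open>x \<noteq> 0\<close> in \<open>simp add: dist_norm algebra_simps \<epsilon>_def\<close>)
  define \<mu> where "\<mu> = \<epsilon> * a / (\<epsilon>\<^sup>2 * a + b + 2 * \<epsilon> * a)"
  have den: "\<epsilon>\<^sup>2 * a + b + 2 * \<epsilon> * a > 0" using pos by (simp add: add_nonneg_pos)
  have \<mu>: "0 < \<mu>" "\<mu> < 1" "\<mu> * (\<epsilon>\<^sup>2 * a + b + 2 * \<epsilon> * a) = \<epsilon> * a"
  proof -
    show "0 < \<mu>" using den pos by (simp add: \<mu>_def)
    have "\<epsilon> * a > 0" "\<epsilon>\<^sup>2 * a > 0" using pos by auto
    then have "\<epsilon> * a < \<epsilon>\<^sup>2 * a + b + 2 * \<epsilon> * a" using pos by linarith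
    then show "\<mu> < 1" using den by (simp add: \<mu>_def)
    show "\<mu> * (\<epsilon>\<^sup>2 * a + b + 2 * \<epsilon> * a) = \<epsilon> * a" using den by (simp add: \<mu>_def)
  qed
  define y where "y = (1 / (1 - \<mu>)) *\<^sub>R ((1 - \<mu> - \<mu> * \<epsilon>) *\<^sub>R x - \<mu> *\<^sub>R w)"
  have "norm ((1 - \<mu> - \<mu> * \<epsilon>) *\<^sub>R x - \<mu> *\<^sub>R w) ^ 2 = (1 - \<mu> - \<mu> * \<epsilon>)^2 * a + \<mu>^2 * b"
    unfolding power2_norm_eq_inner a_def b_def using orth
    by (simp add: inner_diff orthogonal_def inner_commute power2_eq_square algebra_simps)
  also have "\<dots> = (1 - \<mu>)^2 * a - \<mu> * (2 * \<epsilon> * a - \<mu> * (\<epsilon>\<^sup>2 * a + b + 2 * \<epsilon> * a))"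
    by (simp add: power2_eq_square algebra_simps)
  also have "\<dots> < (1 - \<mu>)^2 * a" using \<mu> pos by (simp add: \<mu>(3))
  finally have "norm ((1 - \<mu> - \<mu> * \<epsilon>) *\<^sub>R x - \<mu> *\<^sub>R w) ^ 2 < ((1 - \<mu>) * norm x) ^ 2"
    by (simp add: a_def power_mult_distrib)
  then have "norm ((1 - \<mu> - \<mu> * \<epsilon>) *\<^sub>R x - \<mu> *\<^sub>R w) < (1 - \<mu>) * norm x"
    by (rule power2_less_imp_less) (use \<mu> in auto)
  then have "norm y < norm x" using \<mu> by (simp add: y_def divide_simps mult.commute)
  moreover have "y \<in> W" unfolding y_def using W by (intro subspace_scale subspace_diff) auto
  ultimately have "q + y \<in> \<Omega>" by (rule ball[rotated])
  with p have "(1 - \<mu>) *\<^sub>R (q + y) + \<mu> *\<^sub>R (q + (1 + \<epsilon>) *\<^sub>R x + w) \<in> \<Omega>"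
    using convexD[OF \<Omega>(2), of "q + y" "q + (1 + \<epsilon>) *\<^sub>R x + w" "1 - \<mu>" \<mu>] \<mu> by simp
  moreover have "(1 - \<mu>) *\<^sub>R y = (1 - \<mu> - \<mu> * \<epsilon>) *\<^sub>R x - \<mu> *\<^sub>R w" using \<mu> by (simp add: y_def)
  then have "(1 - \<mu>) *\<^sub>R (q + y) + \<mu> *\<^sub>R (q + (1 + \<epsilon>) *\<^sub>R x + w) = q + x"
    by (simp add: algebra_simps)
  ultimately show False using x by simp
qed

lemma hermitian_complement:
  fixes W :: "(complex ^ 'n::finite) set"
  assumes W: "vec.subspace W" and x: "x \<in> W" "x \<noteq> 0"
  defines "W' \<equiv> {w \<in> W. herm w x = 0}"
  shows "vec.subspace W'" "vec.span (insert x W') = W" "vec.dim W = Suc (vec.dim W')"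
proof -
  show sub: "vec.subspace W'"
    using W by (auto simp: W'_def vec.subspace_def herm_add_left herm_smult_left)
  show span: "vec.span (insert x W') = W"
  proof
    show "vec.span (insert x W') \<subseteq> W"
      by (rule vec.span_minimal) (use W x in \<open>auto simp: W'_def\<close>)
    show "W \<subseteq> vec.span (insert x W')"
    proof
      fix w assume "w \<in> W"
      then have "w - (herm w x / herm x x) *s x \<in> W'"
        using W x by (simp add: W'_def herm_diff_left herm_smult_left
            vec.subspace_diff vec.subspace_scale)
      then show "w \<in> vec.span (insert x W')"
        by (subst vec.span_breakdown_eq) (meson vec.span_base)
    qed
  qed
  have "x \<notin> vec.span W'" using sub x by (simp add: vec.span_eq_iff[THEN iffD2] W'_def)
  then have "vec.dim (insert x W') = Suc (vec.dim W')" by (simp add: vec.dim_insert)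
  then show "vec.dim W = Suc (vec.dim W')" using span vec.dim_span by metis
qed

lemma exists_orthogonal_frontier_basis:
  fixes W :: "(complex ^ 'n::finite) set" and S :: "'a::linorder set"
  assumes dom: "C_properly_convex_domain \<Omega>" and q: "q \<in> \<Omega>"
    and "finite S" "vec.subspace W" "vec.dim W = card S"
  shows "\<exists>b. vec.span (b ` S) = W \<and> pairwise (\<lambda>i j. herm (b i) (b j) = 0) S \<and>
    (\<forall>j\<in>S. b j \<noteq> 0 \<and> q + b j \<in> frontier \<Omega> \<and> (\<forall>c. cmod c < 1 \<longrightarrow> q + c *s b j \<in> \<Omega>) \<and>
       (\<forall>w\<in>vec.span (b ` {i\<in>S. j < i}). q + b j + w \<notin> \<Omega>))"
  using assms(3-)
proof (induction S arbitrary: W rule: finite_linorder_min_induct)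
  case empty
  then have "W = {0}" using vec.dim_eq_0 vec.subspace_0 by fastforce
  then show ?case by (simp add: pairwise_def)
next
  case (insert m S)
  have \<Omega>: "open \<Omega>" "convex \<Omega>" using dom by (auto simp: C_properly_convex_domain_def)
  have "m \<notin> S" using insert.hyps by auto
  then have dimW: "vec.dim W = Suc (card S)" using insert by simp
  then have "W \<noteq> {0}" by auto
  from nearest_frontier_point_in_subspace[OF dom q insert.prems(1) this]
  obtain x where x: "x \<in> W" "x \<noteq> 0" "q + x \<in> frontier \<Omega>"
    and ball: "\<And>y. y \<in> W \<Longrightarrow> norm y < norm x \<Longrightarrow> q + y \<in> \<Omega>" by blast
  have notin: "q + x \<notin> \<Omega>" using x \<Omega>(1) frontier_disjoint_eq[of \<Omega>] by auto
  define W' where "W' = {w \<in> W. herm w x = 0}"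
  note compl = hermitian_complement[OF insert.prems(1) x(1,2), folded W'_def]
  obtain b where b: "vec.span (b ` S) = W'" "pairwise (\<lambda>i j. herm (b i) (b j) = 0) S"
    "\<And>j. j \<in> S \<Longrightarrow> b j \<noteq> 0 \<and> q + b j \<in> frontier \<Omega> \<and> (\<forall>c. cmod c < 1 \<longrightarrow> q + c *s b j \<in> \<Omega>) \<and>
       (\<forall>w\<in>vec.span (b ` {i\<in>S. j < i}). q + b j + w \<notin> \<Omega>)"
    using insert.IH[of W'] compl dimW by auto
  define b' where "b' = b(m := x)"
  have b'S: "b' ` A = b ` A" if "A \<subseteq> S" for A
    using that \<open>m \<notin> S\<close> by (auto simp: b'_def)
  have b'm: "b' m = x" and b'j: "\<And>j. j \<in> S \<Longrightarrow> b' j = b j"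
    using \<open>m \<notin> S\<close> by (auto simp: b'_def)
  have bW': "b j \<in> W'" if "j \<in> S" for j using that b(1) vec.span_base by blast
  have "vec.span (b' ` insert m S) = W"
  proof -
    have "vec.span (b' ` insert m S) = vec.span (insert x (vec.span (b ` S)))"
      by (simp add: b'S b'm vec.span_insert vec.span_span)
    then show ?thesis using b(1) compl(2) by metis
  qed
  moreover have "pairwise (\<lambda>i j. herm (b' i) (b' j) = 0) (insert m S)"
  proof -
    have "herm (b j) x = 0" "herm x (b j) = 0" if "j \<in> S" for j
      using bW'[OF that] herm_commute[of x "b j"] by (auto simp: W'_def)
    then show ?thesis using b(2) by (auto simp: pairwise_insert b'm b'j pairwise_def)
  qed
  moreover have "b' j \<noteq> 0 \<and> q + b' j \<in> frontier \<Omega> \<and> (\<forall>c. cmod c < 1 \<longrightarrow> q + c *s b' j \<in> \<Omega>) \<and>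
       (\<forall>w\<in>vec.span (b' ` {i\<in>insert m S. j < i}). q + b' j + w \<notin> \<Omega>)" if j: "j \<in> insert m S" for j
  proof (cases "j = m")
    case True
    have "{i\<in>insert m S. m < i} = S" using insert.hyps by auto
    then have "vec.span (b' ` {i\<in>insert m S. m < i}) = W'" by (simp add: b'S b(1))
    moreover have "q + x + w \<notin> \<Omega>" if "w \<in> W'" for w
    proof (rule tangent_plane_disjoint_if_ball_subset[OF \<Omega> notin _ x(1) _ ball])
      show "orthogonal x w"
        using that inner_eq_Re_herm[of w x] by (simp add: W'_def orthogonal_def inner_commute)
    qed (use that x insert.prems subspace_if_vec_subspace in \<open>auto simp: W'_def\<close>)
    moreover have "q + c *s x \<in> \<Omega>" if "cmod c < 1" for c
      using that x insert.prems by (intro ball vec.subspace_scale) (auto simp: norm_smult_vec)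
    ultimately show ?thesis using x True by (simp add: b'm)
  next
    case False
    then have "j \<in> S" using j by simp
    have "{i\<in>insert m S. j < i} = {i\<in>S. j < i}" using \<open>j \<in> S\<close> insert.hyps by auto
    then have "b' ` {i\<in>insert m S. j < i} = b ` {i\<in>S. j < i}" by (simp add: b'S)
    then show ?thesis using b(3)[OF \<open>j \<in> S\<close>] by (simp add: b'j[OF \<open>j \<in> S\<close>])
  qed
  ultimately show ?case by blast
qed

lemma disc_subset_if_subset_closure:
  fixes q u :: "complex ^ 'n::finite"
  assumes \<Omega>: "open \<Omega>" "convex \<Omega>" and "q \<in> \<Omega>"
    and cl: "\<And>c. cmod c < 1 \<Longrightarrow> q + c *s u \<in> closure \<Omega>" and c: "cmod c < 1"
  shows "q + c *s u \<in> \<Omega>"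
proof -
  define s where "s = (1 + cmod c) / 2"
  have s: "0 < s" "s < 1" "cmod c < s" using c by (auto simp: s_def add_pos_nonneg)
  define x where "x = q + (c / of_real s) *s u"
  have "x \<in> closure \<Omega>" unfolding x_def by (rule cl) (use s in \<open>simp add: norm_divide\<close>)
  then have "x - (1 - s) *\<^sub>R (x - q) \<in> interior \<Omega>"
    by (intro mem_interior_closure_convex_shrink) (use s \<Omega> \<open>q \<in> \<Omega>\<close> in \<open>auto simp: interior_open\<close>)
  moreover have "s *\<^sub>R ((c / of_real s) *s u) = c *s u"
    using s by (simp flip: of_real_smult_vec)
  then have "x - (1 - s) *\<^sub>R (x - q) = q + c *s u"
    by (simp add: x_def algebra_simps)
  ultimately show ?thesis using \<Omega>(1) by (simp add: interior_open)
qed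

text \<open>
  This set is compact, and its element of largest norm realizes the maximum of \<open>bdist_dir \<Omega> q\<close> over
  \<open>V\<close>; this avoids any discussion of the continuity of \<open>bdist_dir \<Omega> q\<close>.
\<close>

definition disc_vectors ::
    "(complex ^ 'n::finite) set \<Rightarrow> complex ^ 'n \<Rightarrow> (complex ^ 'n) set \<Rightarrow> (complex ^ 'n) set" where
  "disc_vectors \<Omega> q V = {u \<in> V. \<forall>c. cmod c < 1 \<longrightarrow> q + c *s u \<in> closure \<Omega>}"

lemma compact_disc_vectors:
  assumes dom: "C_properly_convex_domain \<Omega>" and q: "q \<in> \<Omega>" and V: "vec.subspace V"
  shows "compact (disc_vectors \<Omega> q V)"
proof -
  have \<Omega>: "open \<Omega>" "convex \<Omega>" using dom by (auto simp: C_properly_convex_domain_def)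
  have "closed V" by (simp add: V closed_subspace subspace_if_vec_subspace)
  moreover have "closed ((\<lambda>u. q + c *s u) -` closure \<Omega>)" for c
    by (intro closed_vimage closed_closure continuous_intros)
  moreover have "disc_vectors \<Omega> q V = V \<inter> (\<Inter>c\<in>ball 0 1. (\<lambda>u. q + c *s u) -` closure \<Omega>)"
    by (auto simp: disc_vectors_def)
  ultimately have "closed (disc_vectors \<Omega> q V)" by auto
  moreover have "bounded (disc_vectors \<Omega> q V)"
  proof (rule ccontr)
    assume "\<not> bounded (disc_vectors \<Omega> q V)"
    then have "\<exists>u. u \<in> disc_vectors \<Omega> q V \<and> norm u > real n + 1" for n :: nat
      unfolding bounded_iff by (meson not_le)
    then obtain u where u: "\<And>n. u n \<in> disc_vectors \<Omega> q V" "\<And>n :: nat. norm (u n) > real n + 1"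
      by metis
    define w where "w n = (1 / norm (u n)) *\<^sub>R u n" for n
    have "norm (w n) = 1" for n using u(2)[of n] by (auto simp: w_def)
    then have "\<forall>n. w n \<in> sphere 0 1" by simp
    then obtain l k where l: "l \<in> sphere 0 1" "strict_mono (k :: nat \<Rightarrow> nat)" "(w \<circ> k) \<longlonglongrightarrow> l"
      using compact_sphere[of 0 1] unfolding compact_def by blast
    have closure: "q + c *s l \<in> closure \<Omega>" for c
    proof (rule Lim_in_closed_set[OF closed_closure _ sequentially_bot])
      have "continuous_on UNIV (\<lambda>x. q + c *s x)" by (intro continuous_intros)
      from continuous_on_tendsto_compose[OF this l(3)]
      show "(\<lambda>n. q + c *s w (k n)) \<longlonglongrightarrow> q + c *s l" by simp
      have "q + c *s w (k n) \<in> closure \<Omega>" if "n \<ge> nat \<lceil>cmod c\<rceil>" for n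
      proof -
        have "cmod c \<le> real n" using that by linarith
        also have "\<dots> \<le> real (k n)" using seq_suble[OF l(2)] by simp
        also have "\<dots> < norm (u (k n))" using u(2)[of "k n"] by linarith
        finally have "cmod c < norm (u (k n))" .
        moreover from this have "norm (u (k n)) > 0" using norm_ge_zero[of c] by linarith
        ultimately have "cmod (c * of_real (1 / norm (u (k n)))) < 1"
          by (simp only: norm_mult norm_of_real) (simp add: divide_simps)
        then have "q + (c * of_real (1 / norm (u (k n)))) *s u (k n) \<in> closure \<Omega>"
          using u(1)[of "k n"] unfolding disc_vectors_def by blast
        moreover have "(c * of_real (1 / norm (u (k n)))) *s u (k n) = c *s w (k n)"
          unfolding w_def of_real_smult_vec[symmetric] by simp
        ultimately show ?thesis by simp
      qed
      then show "\<forall>\<^sub>F n in sequentially. q + c *s w (k n) \<in> closure \<Omega>"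
        unfolding eventually_sequentially by blast
    qed
    have "q + c *s l \<in> \<Omega>" for c
    proof -
      have pos: "cmod c + 1 > 0" by (simp add: add_nonneg_pos)
      then have nz: "complex_of_real (cmod c + 1) \<noteq> 0" unfolding of_real_eq_0_iff by simp
      have "q + (c / of_real (cmod c + 1)) *s (of_real (cmod c + 1) *s l) \<in> \<Omega>"
      proof (rule disc_subset_if_subset_closure[OF \<Omega> q])
        show "cmod (c / complex_of_real (cmod c + 1)) < 1"
          using pos by (simp only: norm_divide norm_of_real) simp
      qed (simp only: vec.scale_scale closure)
      then show ?thesis
        by (simp only: vec.scale_scale times_divide_eq_left nonzero_mult_div_cancel_right[OF nz])
    qed
    then have "complex_line q l \<subseteq> \<Omega>" by (auto simp: complex_line_def)
    moreover have "l \<noteq> 0" using l(1) by auto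
    ultimately show False using dom unfolding C_properly_convex_domain_def by blast
  qed
  ultimately show ?thesis by (simp add: compact_eq_bounded_closed)
qed

lemma bdist_dir_attains_max:
  assumes dom: "C_properly_convex_domain \<Omega>" and q: "q \<in> \<Omega>"
    and V: "vec.subspace V" "v0 \<in> V" "v0 \<noteq> 0"
  obtains \<delta> where "\<delta> \<in> {bdist_dir \<Omega> q v | v. v \<in> V \<and> v \<noteq> 0}"
    "\<And>t. t \<in> {bdist_dir \<Omega> q v | v. v \<in> V \<and> v \<noteq> 0} \<Longrightarrow> t \<le> \<delta>"
    "\<And>u. u \<in> disc_vectors \<Omega> q V \<Longrightarrow> norm u \<le> \<delta>" "0 < \<delta>"
proof -
  have \<Omega>: "open \<Omega>" "convex \<Omega>" using dom by (auto simp: C_properly_convex_domain_def)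
  define T where "T = disc_vectors \<Omega> q V"
  have scaled: "\<exists>u\<in>T. norm u = bdist_dir \<Omega> q v" if v: "v \<in> V" "v \<noteq> 0" for v
  proof
    define \<rho> where "\<rho> = bdist_dir \<Omega> q v"
    have far: "\<rho> \<le> cmod c * norm v" if "q + c *s v \<in> frontier \<Omega>" for c
    proof -
      have "q + c *s v \<in> frontier \<Omega> \<inter> complex_line q v" using that by (auto simp: complex_line_def)
      from infdist_le[OF this, of q] show ?thesis
        by (simp add: \<rho>_def bdist_dir_def dist_norm norm_smult_vec)
    qed
    have "\<rho> \<ge> 0" by (simp add: \<rho>_def bdist_dir_def infdist_nonneg)
    let ?u = "of_real (\<rho> / norm v) *s v"
    show "norm ?u = bdist_dir \<Omega> q v"
      using v \<open>\<rho> \<ge> 0\<close> by (simp add: norm_smult_vec norm_divide flip: \<rho>_def)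
    have "q + c *s ?u \<in> closure \<Omega>" if "cmod c < 1" for c
    proof (cases "\<rho> = 0")
      case True
      then show ?thesis using q closure_subset by auto
    next
      case False
      then have "q + (c * of_real (\<rho> / norm v)) *s v \<in> \<Omega>"
        using \<open>\<rho> \<ge> 0\<close> v that
        by (intro disc_subset_if_frontier_far[OF q _ far]) (auto simp: norm_mult norm_divide)
      then show ?thesis using closure_subset by auto
    qed
    then show "?u \<in> T" using V v by (simp add: T_def disc_vectors_def vec.subspace_scale)
  qed
  have "compact T" unfolding T_def by (rule compact_disc_vectors[OF dom q V(1)])
  moreover have "T \<noteq> {}" using scaled V by blast
  ultimately obtain u where u: "u \<in> T" "\<And>w. w \<in> T \<Longrightarrow> norm w \<le> norm u"
    using continuous_attains_sup[of T norm] continuous_on_norm_id by blast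
  have upper: "bdist_dir \<Omega> q v \<le> norm u" if "v \<in> V" "v \<noteq> 0" for v
    using scaled[OF that] u(2) by metis
  obtain e where e: "e > 0" "ball q e \<subseteq> \<Omega>" using \<Omega>(1) q open_contains_ball by blast
  have "of_real (e / norm v0) *s v0 \<in> T"
  proof -
    have "q + (c * of_real (e / norm v0)) *s v0 \<in> \<Omega>" if "cmod c < 1" for c
    proof -
      have "dist q (q + (c * of_real (e / norm v0)) *s v0) = cmod c * e"
        using V e by (simp add: dist_norm norm_smult_vec norm_mult norm_divide)
      also have "\<dots> < e" using that e by simp
      finally show ?thesis using e(2) by auto
    qed
    then show ?thesis
      using V closure_subset[of \<Omega>] by (auto simp: T_def disc_vectors_def vec.subspace_scale)
  qed
  from u(2)[OF this] have "e \<le> norm u" using V e by (simp add: norm_smult_vec norm_divide)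
  then have "norm u > 0" using e by linarith
  then have uV: "u \<in> V" "u \<noteq> 0" using u(1) by (auto simp: T_def disc_vectors_def)
  have "norm u \<le> bdist_dir \<Omega> q u"
  proof -
    have "norm u \<le> dist q x" if "x \<in> frontier \<Omega> \<inter> complex_line q u" for x
    proof -
      from that obtain c where c: "x = q + c *s u" unfolding complex_line_def by blast
      have "x \<notin> \<Omega>" using that \<Omega>(1) frontier_disjoint_eq[of \<Omega>] by auto
      then have "cmod c \<ge> 1"
        using disc_subset_if_subset_closure[OF \<Omega> q, of u c] u(1) c
        by (force simp: T_def disc_vectors_def)
      then have "1 * norm u \<le> cmod c * norm u" by (intro mult_right_mono) auto
      then show ?thesis by (simp add: c dist_norm norm_smult_vec)
    qed
    then show ?thesis
      unfolding bdist_dir_def using frontier_on_line[OF dom q uV(2)]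
      by (subst infdist_notempty) (auto intro: cINF_greatest)
  qed
  with upper uV have "norm u = bdist_dir \<Omega> q u" by fastforce
  with that[of "norm u"] show thesis using uV upper u(2) \<open>norm u > 0\<close> unfolding T_def by blast
qed

lemma ball_subset_at_segment_point:
  fixes \<xi> z0 w :: "complex ^ 'n::finite"
  assumes \<Omega>: "open \<Omega>" "convex \<Omega>" and "z0 \<in> \<Omega>" "\<xi> \<in> closure \<Omega>"
    and t: "0 < t" "t \<le> 1" and w: "norm w < t * bdist \<Omega> z0"
  shows "(1 - t) *\<^sub>R \<xi> + t *\<^sub>R z0 + w \<in> \<Omega>"
proof -
  have "bdist \<Omega> z0 \<le> cmod c * norm ((1 / t) *\<^sub>R w)"
    if "z0 + c *s ((1 / t) *\<^sub>R w) \<in> frontier \<Omega>" for c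
    using infdist_le[OF that, of z0] by (simp add: bdist_def dist_norm norm_smult_vec)
  from disc_subset_if_frontier_far[OF \<open>z0 \<in> \<Omega>\<close> _ this, of 1]
  have "z0 + (1 / t) *\<^sub>R w \<in> \<Omega>" using w t by (simp add: divide_simps mult.commute)
  then have "\<xi> - t *\<^sub>R (\<xi> - (z0 + (1 / t) *\<^sub>R w)) \<in> interior \<Omega>"
    using assms by (intro mem_interior_closure_convex_shrink) (auto simp: interior_open)
  moreover have "\<xi> - t *\<^sub>R (\<xi> - (z0 + (1 / t) *\<^sub>R w)) = (1 - t) *\<^sub>R \<xi> + t *\<^sub>R z0 + w"
    using t by (simp add: algebra_simps)
  ultimately show ?thesis using \<Omega>(1) by (simp add: interior_open)
qed

lemma matrix_vector_mult_axis:
  fixes A :: "'a::semiring_1 ^ 'n::finite ^ 'm"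
  shows "A *v axis k 1 = column k A"
  by (simp add: vec_eq_iff matrix_vector_mult_def column_def axis_def if_distrib cong: if_cong)

lemma affine_image_in_K_family:
  fixes \<Omega> :: "(complex ^ 'n::{finite,linorder}) set" and b :: "'n \<Rightarrow> complex ^ 'n::{finite,linorder}"
  assumes dom: "C_properly_convex_domain \<Omega>" and q: "q \<in> \<Omega>" and r: "0 < r" "r \<le> 1"
    and BN: "B ** N = mat 1" "N ** B = mat 1" and col: "\<And>j. column j B = b j"
    and disc1: "\<And>c. cmod c < r \<Longrightarrow> q + c *s b idx1 \<in> \<Omega>"
    and disc: "\<And>j c. j \<noteq> idx1 \<Longrightarrow> cmod c < 1 \<Longrightarrow> q + c *s b j \<in> \<Omega>"
    and fr: "\<And>j. q + b j \<in> frontier \<Omega>"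
    and flag: "\<And>j w. w \<in> vec.span (b ` {j<..}) \<Longrightarrow> q + b j + w \<notin> \<Omega>"
  shows "(\<lambda>z. N *v (z - q)) ` \<Omega> \<in> K_family r"
proof -
  have \<Omega>: "open \<Omega>" "convex \<Omega>" using dom by (auto simp: C_properly_convex_domain_def)
  define A where "A z = N *v (z - q)" for z
  have NB: "N *v (B *v x) = x" and BN': "B *v (N *v x) = x" for x
    by (simp_all add: matrix_vector_mul_assoc BN)
  have image: "A ` \<Omega> = (\<lambda>y. q + B *v y) -` \<Omega>"
  proof -
    have "A (q + B *v y) = y" "q + B *v A z = z" for y z by (simp_all add: A_def NB BN')
    then show ?thesis by (metis (no_types, lifting) ext image_iff set_eqI vimage_eq)
  qed
  have Bax: "B *v std_basis j = b j" for j by (simp add: matrix_vector_mult_axis col)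
  have Bsm: "B *v (c *s x) = c *s (B *v x)" for c x by (rule vec.scale)
  have contB: "continuous_on UNIV (\<lambda>y. q + B *v y)"
    by (intro continuous_intros linear_continuous_on matrix_vector_mul_bounded_linear)
  have openA: "open (A ` \<Omega>)"
    unfolding image using open_vimage[OF \<Omega>(1) contB] .
  have "convex (A ` \<Omega>)"
  proof -
    have "A ` \<Omega> = ((*v) N) ` ((\<lambda>z. z - q) ` \<Omega>)" by (auto simp: A_def)
    then show ?thesis using \<Omega>(2) by (simp add: convex_linear_image convex_translation_subtract_eq)
  qed
  moreover have "\<not> complex_line z v \<subseteq> A ` \<Omega>" if "v \<noteq> 0" for z v
  proof
    assume "complex_line z v \<subseteq> A ` \<Omega>"
    then have "q + B *v (z + c *s v) \<in> \<Omega>" for c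
      unfolding image complex_line_def by blast
    then have "complex_line (q + B *v z) (B *v v) \<subseteq> \<Omega>"
      by (auto simp: complex_line_def matrix_vector_right_distrib Bsm add.assoc)
    moreover have "B *v v \<noteq> 0" using that NB[of v] by auto
    ultimately show False using dom unfolding C_properly_convex_domain_def by blast
  qed
  ultimately have "C_properly_convex_domain (A ` \<Omega>)"
    using openA q by (auto simp: C_properly_convex_domain_def)
  moreover have "(\<lambda>c. c *s std_basis idx1) ` ball 0 r \<subseteq> A ` \<Omega>"
    using disc1 by (auto simp: image Bsm Bax)
  moreover have "(\<lambda>c. c *s std_basis j) ` ball 0 1 \<subseteq> A ` \<Omega>" if "j \<noteq> idx1" for j
    using disc[OF that] by (auto simp: image Bsm Bax)
  moreover have "std_basis j \<in> frontier (A ` \<Omega>)" for j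
  proof -
    have "A ` closure \<Omega> \<subseteq> closure (A ` \<Omega>)"
    proof (rule image_closure_subset)
      show "continuous_on (closure \<Omega>) A"
        unfolding A_def matrix_vector_mult_diff_distrib
        by (intro continuous_on_diff continuous_on_const linear_continuous_on
            matrix_vector_mul_bounded_linear)
    qed (auto simp: closure_subset)
    moreover have "q + b j \<in> closure \<Omega>" "q + b j \<notin> \<Omega>"
      using fr[of j] \<Omega>(1) by (auto simp: frontier_def interior_open)
    moreover have "A (q + b j) = std_basis j" by (simp add: A_def NB flip: Bax)
    ultimately show ?thesis
      using openA by (auto simp: frontier_def interior_open image Bax)
  qed
  moreover have "((+) (std_basis j) ` vec.span (std_basis ` {j<..})) \<inter> A ` \<Omega> = {}" for j
  proof -
    have "(*v) B ` vec.span (std_basis ` {j<..}) = vec.span (b ` {j<..})"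
      by (simp add: image_image Bax flip: vec.span_image)
    then have "q + B *v (std_basis j + w) \<notin> \<Omega>" if "w \<in> vec.span (std_basis ` {j<..})" for w
      using flag[of "B *v w" j] that by (auto simp: matrix_vector_right_distrib Bax add.assoc)
    then show ?thesis by (auto simp: image)
  qed
  ultimately show ?thesis using r unfolding K_family_def A_def by blast
qed

theorem theorem4p3:
  fixes \<Omega> H :: "(complex ^ 'n::{finite,linorder}) set"
    and z0 \<xi> q :: "complex ^ 'n::{finite,linorder}"
    and r :: real
  assumes "C_properly_convex_domain \<Omega>"
    and "z0 \<in> \<Omega>"
    and "\<xi> \<in> frontier \<Omega>"
    and "supporting_complex_hyperplane \<Omega> \<xi> H"
    and "q \<in> closed_segment \<xi> z0 - {\<xi>}"
    and "r = bdist \<Omega> z0 / norm (\<xi> - z0)"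
  shows "\<exists>A. affine_automorphism A \<and>
    A ` \<Omega> \<in> K_family r \<and>
    A q = 0 \<and>
    A \<xi> = std_basis idx1 \<and>
    A ` H = (+) (std_basis idx1) ` vec.span (std_basis ` {idx1<..}) \<and>
    (CARD('n) \<ge> 2 \<longrightarrow>
      (\<exists>\<delta>H. \<delta>H \<in> {bdist_dir \<Omega> q v | v. v \<in> (+) (- \<xi>) ` H \<and> v \<noteq> 0} \<and>
        (\<forall>t \<in> {bdist_dir \<Omega> q v | v. v \<in> (+) (- \<xi>) ` H \<and> v \<noteq> 0}. t \<le> \<delta>H) \<and>
        (\<forall>z1 z2. norm (A z1 - A z2) \<ge> r / (sqrt 2 * \<delta>H) * norm (z1 - z2))))"
proof -
  note dom = assms(1)
  have \<Omega>: "open \<Omega>" "convex \<Omega>" using dom by (auto simp: C_properly_convex_domain_def)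
  have \<xi>: "\<xi> \<in> closure \<Omega>" "\<xi> \<notin> \<Omega>"
    using assms(3) \<Omega>(1) by (auto simp: frontier_def interior_open)
  obtain V where V: "vec.subspace V" "vec.dim V = CARD('n) - 1" and H: "H = (+) \<xi> ` V"
    and disj: "H \<inter> \<Omega> = {}"
  proof -
    obtain a V where aV: "vec.subspace V" "vec.dim V = CARD('n) - 1" "H = (+) a ` V"
      "\<xi> \<in> H" "H \<inter> \<Omega> = {}"
      using assms(4) unfolding supporting_complex_hyperplane_def complex_affine_hyperplane_def by blast
    then obtain v where v: "v \<in> V" "\<xi> = a + v" by auto
    have "x \<in> (+) v ` V" if "x \<in> V" for x
      using vec.subspace_diff[OF aV(1) that v(1)] by (intro image_eqI[of _ _ "x - v"]) auto
    then have "(+) v ` V = V" using vec.subspace_add[OF aV(1) v(1)] by blast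
    moreover have "H = (+) a ` V" by (rule aV(3))
    moreover have "(+) \<xi> ` V = (+) a ` ((+) v ` V)"
      by (simp add: v(2) image_image add.assoc)
    ultimately have "H = (+) \<xi> ` V" by simp
    then show thesis using that aV by blast
  qed
  have V_eq: "(+) (- \<xi>) ` H = V" by (simp add: H image_image)
  obtain t where t: "0 \<le> t" "t \<le> 1" "q = (1 - t) *\<^sub>R \<xi> + t *\<^sub>R z0"
    using assms(5) by (auto simp: in_segment)
  have "t \<noteq> 0" using t assms(5) by auto
  with t have "t > 0" by simp
  have \<xi>q: "\<xi> - q = t *\<^sub>R (\<xi> - z0)" using t by (simp add: algebra_simps)
  have pos: "norm (\<xi> - z0) > 0" using assms(2) \<xi> by auto
  have "bdist \<Omega> z0 > 0"
    using in_closed_iff_infdist_zero[OF frontier_closed, of \<Omega> z0] assms(2,3)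
      frontier_disjoint_eq[of \<Omega>] \<Omega>(1) infdist_nonneg[of z0 "frontier \<Omega>"]
    unfolding bdist_def by force
  moreover have "bdist \<Omega> z0 \<le> norm (\<xi> - z0)"
    using infdist_le[OF assms(3), of z0] by (simp add: bdist_def dist_norm norm_minus_commute)
  ultimately have r: "0 < r" "r \<le> 1" using pos by (auto simp: assms(6))
  have r\<xi>q: "r * norm (\<xi> - q) = t * bdist \<Omega> z0"
    using \<open>t > 0\<close> pos by (simp add: \<xi>q assms(6))
  have ball: "q + w \<in> \<Omega>" if "norm w < r * norm (\<xi> - q)" for w
    using ball_subset_at_segment_point[OF \<Omega> assms(2) \<xi>(1) \<open>t > 0\<close> t(2), folded t(3)] that
    unfolding r\<xi>q by blast
  have "\<xi> \<noteq> q" using assms(5) by auto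
  then have "r * norm (\<xi> - q) > 0" using r by simp
  with ball[of 0] have q: "q \<in> \<Omega>" by simp
  have notV: "\<xi> - q \<notin> V"
  proof
    assume "\<xi> - q \<in> V"
    from vec.subspace_neg[OF V(1) this] have "q - \<xi> \<in> V" by simp
    then have "q \<in> H" unfolding H by (auto simp: image_iff intro: bexI[of _ "q - \<xi>"])
    then show False using disj q by blast
  qed

  define J :: "'n set" where "J = {idx1<..}"
  have J: "J = UNIV - {idx1}" by (auto simp: J_def less_le)
  have UJ: "UNIV = insert idx1 J" "idx1 \<notin> J" using J by auto
  have "vec.dim V = card J" using V(2) by (simp add: J card_Diff_singleton)
  from exists_orthogonal_frontier_basis[OF dom q _ V(1) this]
  obtain b0 where b0: "vec.span (b0 ` J) = V" "pairwise (\<lambda>i j. herm (b0 i) (b0 j) = 0) J"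
    "\<And>j. j \<in> J \<Longrightarrow> b0 j \<noteq> 0 \<and> q + b0 j \<in> frontier \<Omega> \<and> (\<forall>c. cmod c < 1 \<longrightarrow> q + c *s b0 j \<in> \<Omega>) \<and>
       (\<forall>w\<in>vec.span (b0 ` {i\<in>J. j < i}). q + b0 j + w \<notin> \<Omega>)"
    by auto
  define b where "b = b0(idx1 := \<xi> - q)"
  have b1: "b idx1 = \<xi> - q" and bJ: "\<And>j. j \<in> J \<Longrightarrow> b j = b0 j"
    using UJ by (auto simp: b_def)
  have bV: "b j \<in> V" if "j \<in> J" for j
    unfolding bJ[OF that] b0(1)[symmetric] using that by (intro vec.span_base) auto
  have gt: "b ` {j<..} = b0 ` {i\<in>J. j < i}" for j
  proof -
    have "{j<..} = {i\<in>J. j < i}" by (auto simp: J_def intro: le_less_trans[rotated])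
    then show ?thesis using bJ by auto
  qed
  define B :: "((complex, 'n) vec, 'n) vec" where "B = (\<chi> i j. b j $ i)"
  have col: "column j B = b j" for j by (simp add: B_def column_def vec_eq_iff)
  have B: "B *v x = x $ idx1 *s (\<xi> - q) + (\<Sum>j\<in>J. x $ j *s b j)" for x
    unfolding matrix_mult_sum col J b1[symmetric] by (rule sum.remove) auto
  have norm_tail: "norm (\<Sum>j\<in>J. x $ j *s b j) ^ 2 = (\<Sum>j\<in>J. (cmod (x $ j) * norm (b j)) ^ 2)" for x
  proof -
    have "pairwise (\<lambda>i j. orthogonal (x $ i *s b i) (x $ j *s b j)) J"
      using b0(2) by (simp add: pairwise_def orthogonal_def inner_eq_Re_herm herm_smult_left
          herm_smult_right bJ)
    then show ?thesis by (simp add: norm_sum_Pythagorean norm_smult_vec)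
  qed
  have tailV: "(\<Sum>j\<in>J. x $ j *s b j) \<in> V" for x
    by (intro vec.subspace_sum vec.subspace_scale V(1) bV)
  have "x = 0" if "B *v x = 0" for x
  proof -
    have "x $ idx1 = 0"
    proof (rule ccontr)
      assume nz: "x $ idx1 \<noteq> 0"
      have "x $ idx1 *s (\<xi> - q) = - (\<Sum>j\<in>J. x $ j *s b j)"
        using that B[of x] by (simp add: eq_neg_iff_add_eq_0)
      then have "x $ idx1 *s (\<xi> - q) \<in> V" using tailV vec.subspace_neg[OF V(1)] by simp
      then have "inverse (x $ idx1) *s (x $ idx1 *s (\<xi> - q)) \<in> V"
        by (rule vec.subspace_scale[OF V(1)])
      then show False using notV nz by simp
    qed
    with that have "(\<Sum>j\<in>J. x $ j *s b j) = 0" by (simp add: B)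
    with norm_tail[of x] have "\<forall>j\<in>J. (cmod (x $ j) * norm (b j)) ^ 2 = 0"
      by (simp add: sum_nonneg_eq_0_iff)
    then have "\<forall>j\<in>J. x $ j = 0" using b0(3) bJ by auto
    with \<open>x $ idx1 = 0\<close> UJ(1) show "x = 0" unfolding vec_eq_iff
      by (metis UNIV_I insert_iff zero_index)
  qed
  then have "invertible B"
    using matrix_left_invertible_ker invertible_left_inverse by blast
  then obtain N where BN: "B ** N = mat 1" "N ** B = mat 1" unfolding invertible_def by blast
  have NB: "N *v (B *v x) = x" and BN': "B *v (N *v x) = x" for x
    by (simp_all add: matrix_vector_mul_assoc BN)
  have Nb: "N *v b j = std_basis j" for j
    using NB[of "std_basis j"] by (simp add: matrix_vector_mult_axis col)
  define A where "A z = N *v (z - q)" for z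

  have "affine_automorphism A"
    unfolding affine_automorphism_def
  proof (intro exI conjI)
    show "invertible N" using BN unfolding invertible_def by blast
    show "A = (\<lambda>z. N *v z + - (N *v q))" by (simp add: A_def matrix_vector_mult_diff_distrib fun_eq_iff)
  qed
  moreover have "A ` \<Omega> \<in> K_family r"
    unfolding A_def
  proof (rule affine_image_in_K_family[OF dom q r BN col])
    fix c assume "cmod c < r"
    then show "q + c *s b idx1 \<in> \<Omega>"
      using \<open>\<xi> \<noteq> q\<close> by (intro ball) (simp only: b1 norm_smult_vec, simp)
  next
    fix j :: 'n and c assume "j \<noteq> idx1" "cmod c < 1"
    then show "q + c *s b j \<in> \<Omega>" using b0(3)[of j] bJ[of j] J by auto
  next
    fix j show "q + b j \<in> frontier \<Omega>"
      using b0(3)[of j] bJ[of j] J assms(3) b1 by (cases "j = idx1") auto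
  next
    fix j w assume w: "w \<in> vec.span (b ` {j<..})"
    show "q + b j + w \<notin> \<Omega>"
    proof (cases "j = idx1")
      case True
      then have "w \<in> V" using w b0(1) bJ by (simp add: J_def[symmetric])
      then show ?thesis using disj True by (auto simp: H b1)
    next
      case False
      then show ?thesis using w b0(3)[of j] bJ[of j] J unfolding gt by auto
    qed
  qed
  moreover have "A q = 0" "A \<xi> = std_basis idx1" using Nb[of idx1] by (auto simp: A_def b1)
  moreover have "A ` H = (+) (std_basis idx1) ` vec.span (std_basis ` {idx1<..})"
  proof -
    have "V = vec.span (b ` J)" using b0(1) bJ by simp
    then have "(*v) N ` V = vec.span (std_basis ` J)"
      by (simp add: image_image Nb flip: vec.span_image)
    moreover have "A (\<xi> + v) = std_basis idx1 + N *v v" for v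
      unfolding A_def Nb[of idx1, symmetric] b1 matrix_vector_right_distrib[symmetric]
      by (rule arg_cong[of _ _ "(*v) N"]) simp
    then have "A ` H = (+) (std_basis idx1) ` ((*v) N ` V)" by (simp add: H image_image)
    ultimately show ?thesis by (simp add: J_def)
  qed
  moreover have "\<exists>\<delta>H. \<delta>H \<in> {bdist_dir \<Omega> q v | v. v \<in> V \<and> v \<noteq> 0} \<and>
        (\<forall>t \<in> {bdist_dir \<Omega> q v | v. v \<in> V \<and> v \<noteq> 0}. t \<le> \<delta>H) \<and>
        (\<forall>z1 z2. norm (A z1 - A z2) \<ge> r / (sqrt 2 * \<delta>H) * norm (z1 - z2))"
    if "CARD('n) \<ge> 2"
  proof -
    have "V \<noteq> {0}" using that V(2) by auto
    then obtain v0 where v0: "v0 \<in> V" "v0 \<noteq> 0" using vec.subspace_0[OF V(1)] by blast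
    from bdist_dir_attains_max[OF dom q V(1) v0] obtain \<delta>
      where \<delta>: "\<delta> \<in> {bdist_dir \<Omega> q v | v. v \<in> V \<and> v \<noteq> 0}"
        "\<And>t. t \<in> {bdist_dir \<Omega> q v | v. v \<in> V \<and> v \<noteq> 0} \<Longrightarrow> t \<le> \<delta>"
        "\<And>u. u \<in> disc_vectors \<Omega> q V \<Longrightarrow> norm u \<le> \<delta>" "0 < \<delta>" by blast
    have b\<delta>: "norm (b j) \<le> \<delta>" if "j \<in> J" for j
      using b0(3)[OF that] bV[OF that] closure_subset[of \<Omega>]
      by (intro \<delta>(3)) (auto simp: disc_vectors_def bJ[OF that])
    have \<xi>\<delta>: "r * norm (\<xi> - q) \<le> \<delta>"
    proof -
      let ?\<rho> = "r * norm (\<xi> - q)"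
      let ?u = "of_real (?\<rho> / norm v0) *s v0"
      have norm_u: "norm ?u = ?\<rho>" using v0 r by (simp add: norm_smult_vec norm_divide norm_mult)
      have "q + c *s ?u \<in> \<Omega>" if "cmod c < 1" for c
      proof (rule ball)
        have "norm (c *s ?u) = cmod c * ?\<rho>" unfolding norm_smult_vec[of c] norm_u ..
        also have "\<dots> < 1 * ?\<rho>" by (rule mult_strict_right_mono) fact+
        finally show "norm (c *s ?u) < ?\<rho>" by simp
      qed
      then have "?u \<in> disc_vectors \<Omega> q V"
        using v0 V(1) closure_subset[of \<Omega>] by (auto simp: disc_vectors_def vec.subspace_scale)
      from \<delta>(3)[OF this] norm_u show ?thesis by simp
    qed
    have bound: "norm (B *v x) \<le> sqrt 2 * \<delta> / r * norm x" for x
    proof -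
      define s where "s = sqrt (\<Sum>j\<in>J. cmod (x $ j) ^ 2)"
      have s: "s \<ge> 0" "s\<^sup>2 = (\<Sum>j\<in>J. cmod (x $ j) ^ 2)" by (simp_all add: s_def sum_nonneg)
      have "norm (\<Sum>j\<in>J. x $ j *s b j) ^ 2 \<le> (\<Sum>j\<in>J. (cmod (x $ j) * \<delta>) ^ 2)"
        unfolding norm_tail by (intro sum_mono power_mono mult_left_mono b\<delta>) auto
      also have "\<dots> = (s * \<delta>) ^ 2" by (simp add: power_mult_distrib s(2) sum_distrib_right)
      finally have "norm (\<Sum>j\<in>J. x $ j *s b j) \<le> s * \<delta>"
        by (rule power2_le_imp_le) (use s \<delta>(4) in auto)
      also have "\<dots> \<le> s * (\<delta> / r)"
        using s \<delta>(4) r by (intro mult_left_mono) (simp_all add: field_simps)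
      finally have tail: "norm (\<Sum>j\<in>J. x $ j *s b j) \<le> s * (\<delta> / r)" .
      have head: "norm (x $ idx1 *s (\<xi> - q)) \<le> cmod (x $ idx1) * (\<delta> / r)"
        unfolding norm_smult_vec using \<xi>\<delta> r by (intro mult_left_mono) (simp_all add: field_simps)
      have norm_x: "norm x ^ 2 = cmod (x $ idx1) ^ 2 + s\<^sup>2"
        unfolding norm_vec_def L2_set_def s(2) J
        by (simp add: sum_nonneg sum.remove[of UNIV idx1 "\<lambda>i. cmod (x $ i) ^ 2"])
      have "(cmod (x $ idx1) + s)\<^sup>2 \<le> (sqrt 2 * norm x)\<^sup>2"
        using sum_squares_bound[of "cmod (x $ idx1)" s]
        by (simp add: norm_x power2_sum power_mult_distrib)
      then have "cmod (x $ idx1) + s \<le> sqrt 2 * norm x"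
        by (rule power2_le_imp_le) simp
      then have "(cmod (x $ idx1) + s) * (\<delta> / r) \<le> sqrt 2 * norm x * (\<delta> / r)"
        using \<delta>(4) r by (intro mult_right_mono) auto
      moreover have "norm (B *v x) \<le> (cmod (x $ idx1) + s) * (\<delta> / r)"
        unfolding B distrib_right by (rule norm_triangle_mono[OF head tail])
      ultimately show ?thesis by (simp add: mult_ac)
    qed
    have "r / (sqrt 2 * \<delta>) * norm (z1 - z2) \<le> norm (A z1 - A z2)" for z1 z2
    proof -
      have "A z1 - A z2 = N *v (z1 - z2)"
        by (simp add: A_def flip: matrix_vector_mult_diff_distrib)
      then have "norm (z1 - z2) \<le> sqrt 2 * \<delta> / r * norm (A z1 - A z2)"
        using bound[of "A z1 - A z2"] BN' by simp
      then show ?thesis using r \<delta>(4) by (simp add: field_simps)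
    qed
    with \<delta>(1,2) show ?thesis by blast
  qed
  ultimately show ?thesis unfolding V_eq by blast
qed

end
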